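(* Let $T$ be a forward weighted shift on $\mathcal H$ whose weight sequence $\{w_n\}_{n\in\mathbb N}$ satisfies at least one of the following two conditions: (A) $\displaystyle\sup_{n\ge m\ge2}\ \sum_{k=0}^\infty\left(\frac{w_{k+m}w_{k+m+1}\cdots w_{k+n}}{w_mw_{m+1}\cdots w_n}\right)^2<\infty$; (B) $w_{n+1}\le w_n$ for all $n\ge0$ and $\sum_{n=0}^\infty w_n^2<\infty$. Let $\mathcal M\subseteq\mathcal H$ be an infinite-dimensional closed subspace that is invariant under both $T^{*2}$ and $T^{*3}$. Then $\mathcal M=\mathcal H$.
   Context: $\mathbb N=\{0,1,2,\ldots\}$. $\mathcal H$ is a separable complex Hilbert space with orthonormal basis $\{e_n\}_{n\in\mathbb N}$. Given a bounded sequence $\{w_n\}_{n\in\mathbb N}$ of positive reals, the forward weighted shift is the bounded operator $T$ with $Te_n=w_ne_{n+1}$; its adjoint satisfies $T^*e_0=0$, $T^*e_n=w_{n-1}e_{n-1}$ for $n\ge1$. $T^{*r}=(T^* )^r$. *)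

theory Defs
  imports "HOL-Analysis.Analysis"
begin

class complex_vector = real_vector +
  fixes scaleC :: "complex \<Rightarrow> 'a \<Rightarrow> 'a"  (infixr "*\<^sub>C" 75)
  assumes scaleC_add_right: "a *\<^sub>C (x + y) = a *\<^sub>C x + a *\<^sub>C y"
    and scaleC_add_left: "(a + b) *\<^sub>C x = a *\<^sub>C x + b *\<^sub>C x"
    and scaleC_scaleC: "a *\<^sub>C b *\<^sub>C x = (a * b) *\<^sub>C x"
    and scaleC_one: "1 *\<^sub>C x = x"
    and scaleC_of_real: "complex_of_real r *\<^sub>C x = r *\<^sub>R x"

global_interpretation complex_vector: vector_space "scaleC :: complex \<Rightarrow> 'a \<Rightarrow> 'a::complex_vector"
  defines csubspace = complex_vector.subspace
    and cspan = complex_vector.span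
  by unfold_locales
    (simp_all add: scaleC_add_right scaleC_add_left scaleC_scaleC scaleC_one)

text \<open>The inner product is linear in its first argument.\<close>

class complex_inner = complex_vector + real_normed_vector +
  fixes cinner :: "'a \<Rightarrow> 'a \<Rightarrow> complex"
  assumes cinner_commute: "cinner x y = cnj (cinner y x)"
    and cinner_add_left: "cinner (x + y) z = cinner x z + cinner y z"
    and cinner_scaleC_left: "cinner (a *\<^sub>C x) y = a * cinner x y"
    and cinner_ge_zero: "0 \<le> Re (cinner x x)"
    and cinner_eq_zero_iff: "cinner x x = 0 \<longleftrightarrow> x = 0"
    and norm_eq_sqrt_cinner: "norm x = sqrt (Re (cinner x x))"

class chilbert_space = complex_inner + complete_space

definition orthonormal_basis :: "(nat \<Rightarrow> 'a::chilbert_space) \<Rightarrow> bool" where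
  "orthonormal_basis e \<longleftrightarrow>
     (\<forall>m n. cinner (e m) (e n) = (if m = n then 1 else 0)) \<and>
     closure (cspan (range e)) = UNIV"

definition bounded_clinear :: "('a::complex_inner \<Rightarrow> 'b::complex_inner) \<Rightarrow> bool" where
  "bounded_clinear T \<longleftrightarrow> bounded_linear T \<and> (\<forall>c x. T (c *\<^sub>C x) = c *\<^sub>C T x)"

definition cadjoint :: "('a::chilbert_space \<Rightarrow> 'b::chilbert_space) \<Rightarrow> 'b \<Rightarrow> 'a" where
  "cadjoint T = (SOME S. \<forall>x y. cinner (T x) y = cinner x (S y))"

definition forward_weighted_shift ::
    "(nat \<Rightarrow> 'a::chilbert_space) \<Rightarrow> (nat \<Rightarrow> real) \<Rightarrow> ('a \<Rightarrow> 'a) \<Rightarrow> bool" where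
  "forward_weighted_shift e w T \<longleftrightarrow>
     (\<forall>n. 0 < w n) \<and> bounded (range w) \<and>
     bounded_clinear T \<and> (\<forall>n. T (e n) = complex_of_real (w n) *\<^sub>C e (Suc n))"

definition infinite_cdim :: "'a::complex_vector set \<Rightarrow> bool" where
  "infinite_cdim M \<longleftrightarrow> \<not> (\<exists>B. finite B \<and> cspan B = M)"

text \<open>The sums are taken in the extended nonnegative reals, so that a divergent series
  counts as infinity.\<close>

definition weight_condition_A :: "(nat \<Rightarrow> real) \<Rightarrow> bool" where
  "weight_condition_A w \<longleftrightarrow>
     (SUP (m, n) \<in> {(m, n). 2 \<le> m \<and> m \<le> n}.
        \<Sum>k. ennreal (((\<Prod>j = m..n. w (k + j)) / (\<Prod>j = m..n. w j))\<^sup>2)) < \<infinity>"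

definition weight_condition_B :: "(nat \<Rightarrow> real) \<Rightarrow> bool" where
  "weight_condition_B w \<longleftrightarrow>
     (\<forall>n. w (Suc n) \<le> w n) \<and> summable (\<lambda>n. (w n)\<^sup>2)"

end

theory Submission
  imports Defs
begin

text \<open>If \<open>M\<close> were proper, there would be \<open>f \<noteq> 0\<close> orthogonal to \<open>M\<close>, and then all
  \<open>T\<^sup>r g\<close> with \<open>g = T\<^sup>2 f\<close> and \<open>r \<ge> 0\<close> are orthogonal to \<open>M\<close>. Let \<open>p \<ge> 2\<close> be the index of
  the first nonzero coefficient of \<open>g\<close>. For \<open>x \<in> M\<close>, the equation \<open>\<langle>x, T\<^sup>r g\<rangle> = 0\<close> expresses
  the coefficient of \<open>x\<close> at \<open>p + r\<close> through the later ones, with weights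
  \<open>R\<^sub>k(r) = \<Prod>j<r. w (p + k + j) / w (p + j)\<close> multiplying the coefficients of \<open>g\<close> at \<open>p + k\<close>.
  Either weight condition makes \<open>\<Sum>k. R\<^sub>k(r)\<^sup>2\<close> bounded uniformly in \<open>r \<ge> 1\<close> and forces
  \<open>w \<longlonglongrightarrow> 0\<close>, so \<open>R\<^sub>k(r) \<longlonglongrightarrow> 0\<close> for each \<open>k \<ge> 1\<close>. Hence, from some index \<open>N\<close> that does
  not depend on \<open>x\<close> on, every coefficient of \<open>x\<close> is at most half the supremum of the coefficients
  from \<open>N\<close> on, so these all vanish and \<open>M\<close> is finite-dimensional.\<close>

section \<open>Hilbert spaces\<close>

lemma cinner_add_right: "cinner x (y + z) = cinner x y + cinner x z"
  by (metis cinner_add_left cinner_commute complex_cnj_add)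

lemma cinner_scaleC_right: "cinner x (a *\<^sub>C y) = cnj a * cinner x y"
  by (metis cinner_commute cinner_scaleC_left complex_cnj_mult)

lemma cinner_zero_left [simp]: "cinner 0 y = 0"
  by (metis add_cancel_right_right cinner_add_left)

lemma cinner_diff_left: "cinner (x - y) z = cinner x z - cinner y z"
  by (metis add_diff_cancel cinner_add_left diff_add_cancel)

lemma cinner_diff_right: "cinner x (y - z) = cinner x y - cinner x z"
  by (metis add_diff_cancel cinner_add_right diff_add_cancel)

lemma cinner_self: "cinner x x = complex_of_real ((norm x)\<^sup>2)"
proof -
  have "Im (cinner x x) = 0"
    using arg_cong[OF cinner_commute[of x x], of Im] by simp
  then show ?thesis
    by (simp add: complex_eq_iff norm_eq_sqrt_cinner cinner_ge_zero)
qed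

text \<open>For \<open>y = 0\<close> both sides equal \<open>(norm x)\<^sup>2\<close>, because division by zero yields zero.\<close>

lemma norm_diff_projection:
  "(norm (x - (cinner x y / cinner y y) *\<^sub>C y))\<^sup>2 = (norm x)\<^sup>2 - (cmod (cinner x y))\<^sup>2 / (norm y)\<^sup>2"
proof -
  define c where "c = cinner x y / cinner y y"
  have yx: "cinner y x = cnj (cinner x y)" and yy: "cnj (cinner y y) = cinner y y"
    using cinner_commute by metis+
  have "complex_of_real ((norm (x - c *\<^sub>C y))\<^sup>2) = cinner (x - c *\<^sub>C y) (x - c *\<^sub>C y)"
    by (simp only: cinner_self)
  also have "\<dots> = cinner x x - cnj c * cinner x y - c * cinner y x + c * cnj c * cinner y y"
    by (simp add: cinner_diff_left cinner_diff_right cinner_scaleC_left cinner_scaleC_right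
        algebra_simps)
  also have "\<dots> = cinner x x - cinner x y * cnj (cinner x y) / cinner y y"
    by (cases "cinner y y = 0") (auto simp: c_def yx yy field_simps)
  also have "\<dots> = complex_of_real ((norm x)\<^sup>2 - (cmod (cinner x y))\<^sup>2 / (norm y)\<^sup>2)"
    by (simp add: cinner_self complex_norm_square[symmetric])
  finally show ?thesis
    unfolding c_def of_real_eq_iff .
qed

text \<open>The squared norm of the residual after projecting \<open>x\<close> onto \<open>y\<close>
  is nonnegative.\<close>

lemma cinner_Cauchy_Schwarz: "cmod (cinner x y) \<le> norm x * norm y"
proof (cases "y = 0")
  case True
  then show ?thesis
    using cinner_commute[of x y] by simp
next
  case False
  have "0 \<le> (norm x)\<^sup>2 - (cmod (cinner x y))\<^sup>2 / (norm y)\<^sup>2"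
    unfolding norm_diff_projection[symmetric] by simp
  then have "(cmod (cinner x y))\<^sup>2 \<le> (norm x * norm y)\<^sup>2"
    using False by (simp add: field_simps power_mult_distrib)
  then show ?thesis
    by (rule power2_le_imp_le) simp
qed

global_interpretation cinner: bounded_bilinear cinner
proof
  fix r :: real and x y :: "'a::complex_inner"
  show "cinner (r *\<^sub>R x) y = r *\<^sub>R cinner x y"
    by (simp add: scaleC_of_real[symmetric] cinner_scaleC_left scaleR_conv_of_real)
  show "cinner x (r *\<^sub>R y) = r *\<^sub>R cinner x y"
    by (simp add: scaleC_of_real[symmetric] cinner_scaleC_right scaleR_conv_of_real)
  show "\<exists>K. \<forall>x y::'a. norm (cinner x y) \<le> norm x * norm y * K"
    using cinner_Cauchy_Schwarz by (intro exI[of _ 1]) auto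
qed (fact cinner_add_left cinner_add_right)+

lemma norm_add_square_orthogonal:
  assumes "cinner x y = 0"
  shows "(norm (x + y))\<^sup>2 = (norm x)\<^sup>2 + (norm y)\<^sup>2"
proof -
  have "cinner y x = 0"
    using assms cinner_commute[of y x] by simp
  then have "complex_of_real ((norm (x + y))\<^sup>2) = complex_of_real ((norm x)\<^sup>2 + (norm y)\<^sup>2)"
    using assms unfolding of_real_add cinner_self[symmetric]
    by (simp add: cinner_add_left cinner_add_right)
  then show ?thesis
    unfolding of_real_eq_iff .
qed

lemma parallelogram_law:
  fixes x y :: "'a::complex_inner"
  shows "(norm (x + y))\<^sup>2 + (norm (x - y))\<^sup>2 = 2 * (norm x)\<^sup>2 + 2 * (norm y)\<^sup>2"
proof -
  have "complex_of_real ((norm (x + y))\<^sup>2 + (norm (x - y))\<^sup>2)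
      = complex_of_real (2 * (norm x)\<^sup>2 + 2 * (norm y)\<^sup>2)"
    unfolding of_real_add of_real_mult cinner_self[symmetric]
    by (simp add: cinner_add_left cinner_add_right cinner_diff_left cinner_diff_right)
  then show ?thesis
    unfolding of_real_eq_iff .
qed

section \<open>Closest points, orthogonality to closed subspaces, Riesz representation and
  adjoints\<close>

lemma csubspace_scaleR: "csubspace M \<Longrightarrow> x \<in> M \<Longrightarrow> r *\<^sub>R x \<in> M"
  using complex_vector.subspace_scale[of M x "complex_of_real r"] by (simp add: scaleC_of_real)

text \<open>A minimizing sequence is Cauchy by the parallelogram law, because midpoints of its terms
  stay in \<open>M\<close>. Completeness provides a limit, and closedness keeps it in
  \<open>M\<close>.\<close>

lemma closest_point_csubspace:
  fixes x :: "'a::chilbert_space"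
  assumes M: "csubspace M" "closed M"
  obtains a where "a \<in> M" "\<And>b. b \<in> M \<Longrightarrow> dist x a \<le> dist x b"
proof -
  define d where "d = infdist x M"
  have ne: "M \<noteq> {}"
    using complex_vector.subspace_0[OF M(1)] by auto
  have d_le: "d \<le> dist x b" if "b \<in> M" for b
    using that by (simp add: d_def infdist_le)
  have d0: "0 \<le> d"
    by (simp add: d_def infdist_nonneg)
  have "\<exists>a\<in>M. dist x a < d + 1 / real (Suc n)" for n
  proof (rule ccontr)
    assume "\<not> (\<exists>a\<in>M. dist x a < d + 1 / real (Suc n))"
    then have "d + 1 / real (Suc n) \<le> infdist x M"
      using ne by (auto simp: infdist_def not_less intro!: cINF_greatest)
    then show False
      by (simp add: d_def)
  qed
  then obtain a where aM: "a n \<in> M" and a: "dist x (a n) < d + 1 / real (Suc n)" for n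
    by metis
  have dist_lim: "(\<lambda>n. dist x (a n)) \<longlonglongrightarrow> d"
  proof (rule real_tendsto_sandwich)
    show "\<forall>\<^sub>F n in sequentially. d \<le> dist x (a n)"
      using d_le[OF aM] by simp
    show "\<forall>\<^sub>F n in sequentially. dist x (a n) \<le> d + 1 / real (Suc n)"
      using a by (intro always_eventually allI less_imp_le)
    show "(\<lambda>n. d + 1 / real (Suc n)) \<longlonglongrightarrow> d"
      using tendsto_add[OF tendsto_const LIMSEQ_Suc[OF lim_1_over_n], of d] by simp
  qed simp
  \<comment> \<open>The midpoint \<open>c\<close> of \<open>a m\<close> and \<open>a n\<close> has
    distance at least \<open>d\<close> from \<open>x\<close>, which bounds the sum term of the
    parallelogram law from below.\<close>
  have par: "(dist (a m) (a n))\<^sup>2 \<le> 2 * ((dist x (a m))\<^sup>2 - d\<^sup>2) + 2 * ((dist x (a n))\<^sup>2 - d\<^sup>2)" for m n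
  proof -
    define c where "c = (1 / 2) *\<^sub>R (a m + a n)"
    have "c \<in> M"
      unfolding c_def using M aM by (intro csubspace_scaleR complex_vector.subspace_add)
    then have "d\<^sup>2 \<le> (dist x c)\<^sup>2"
      using d_le d0 by (simp add: power_mono)
    moreover have "(x - a m) + (x - a n) = 2 *\<^sub>R (x - c)"
      by (simp add: c_def algebra_simps scaleR_2)
    then have "norm ((x - a m) + (x - a n)) = 2 * dist x c"
      by (simp add: dist_norm)
    moreover have "norm ((x - a m) - (x - a n)) = dist (a m) (a n)"
      by (simp add: dist_norm norm_minus_commute)
    ultimately show ?thesis
      using parallelogram_law[of "x - a m" "x - a n"]
      by (simp add: dist_norm power_mult_distrib)
  qed
  have "Cauchy a"
  proof (rule metric_CauchyI)
    fix \<epsilon> :: real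
    assume "0 < \<epsilon>"
    have "(\<lambda>n. (dist x (a n))\<^sup>2 - d\<^sup>2) \<longlonglongrightarrow> d\<^sup>2 - d\<^sup>2"
      by (intro tendsto_intros dist_lim)
    \<comment> \<open>With this threshold each of the two summands in \<open>par\<close> is less
      than half of the square of \<open>\<epsilon>\<close>.\<close>
    then have "\<forall>\<^sub>F n in sequentially. (dist x (a n))\<^sup>2 - d\<^sup>2 < \<epsilon>\<^sup>2 / 4"
      by (rule order_tendstoD) (use \<open>0 < \<epsilon>\<close> in simp)
    then obtain N where N: "\<And>n. n \<ge> N \<Longrightarrow> (dist x (a n))\<^sup>2 - d\<^sup>2 < \<epsilon>\<^sup>2 / 4"
      by (auto simp: eventually_sequentially)
    have "dist (a m) (a n) < \<epsilon>" if "m \<ge> N" "n \<ge> N" for m n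
    proof (rule power2_less_imp_less)
      show "(dist (a m) (a n))\<^sup>2 < \<epsilon>\<^sup>2"
        using par[of m n] N[OF that(1)] N[OF that(2)] by argo
    qed (use \<open>0 < \<epsilon>\<close> in simp)
    then show "\<exists>N. \<forall>m\<ge>N. \<forall>n\<ge>N. dist (a m) (a n) < \<epsilon>"
      by blast
  qed
  then obtain b where b: "a \<longlonglongrightarrow> b"
    using Cauchy_convergent convergent_def by blast
  have "dist x b = d"
    using LIMSEQ_unique[OF tendsto_dist[OF tendsto_const b] dist_lim] .
  moreover have "b \<in> M"
    using closed_sequentially[OF M(2)] aM b by blast
  ultimately show thesis
    using that d_le by metis
qed

text \<open>The difference between a point outside \<open>M\<close> and its closest point in
  \<open>M\<close> works: if it were not orthogonal to some \<open>y\<close> in \<open>M\<close>,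
  moving along \<open>y\<close> would come closer.\<close>

lemma ex_orthogonal_to_csubspace:
  fixes M :: "'a::chilbert_space set"
  assumes M: "csubspace M" "closed M" and "M \<noteq> UNIV"
  obtains f where "f \<noteq> 0" "\<And>x. x \<in> M \<Longrightarrow> cinner x f = 0"
proof -
  obtain x where "x \<notin> M"
    using assms by blast
  obtain a where a: "a \<in> M" and min: "\<And>b. b \<in> M \<Longrightarrow> dist x a \<le> dist x b"
    using closest_point_csubspace[OF M] by blast
  define f where "f = x - a"
  have "cinner y f = 0" if y: "y \<in> M" for y
  proof (cases "y = 0")
    case False
    \<comment> \<open>\<open>c *\<^sub>C y\<close> is the projection of \<open>f\<close> onto the
      line through \<open>y\<close>, so \<open>a + c *\<^sub>C y\<close> competes with the closest
      point \<open>a\<close>.\<close>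
    define c where "c = cinner f y / cinner y y"
    have "a + c *\<^sub>C y \<in> M"
      using M a y by (intro complex_vector.subspace_add complex_vector.subspace_scale)
    then have "norm f \<le> norm (f - c *\<^sub>C y)"
      using min[of "a + c *\<^sub>C y"] by (simp add: f_def dist_norm algebra_simps)
    then have "(norm f)\<^sup>2 \<le> (norm (f - c *\<^sub>C y))\<^sup>2"
      by (simp add: power_mono)
    then have "(cmod (cinner f y))\<^sup>2 / (norm y)\<^sup>2 \<le> 0"
      unfolding c_def norm_diff_projection by simp
    then have "cinner f y = 0"
      using False by (simp add: divide_le_0_iff)
    then show ?thesis
      using cinner_commute[of y f] by simp
  qed simp
  moreover have "f \<noteq> 0"
    using a \<open>x \<notin> M\<close> by (auto simp: f_def)
  ultimately show thesis
    using that by blast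
qed

text \<open>For a nonzero functional the kernel is a proper closed subspace, and a suitable multiple
  of a nonzero vector orthogonal to it represents the functional.\<close>

lemma Riesz_representation:
  fixes \<phi> :: "'a::chilbert_space \<Rightarrow> complex"
  assumes "bounded_linear \<phi>" and hom: "\<And>c x. \<phi> (c *\<^sub>C x) = c * \<phi> x"
  shows "\<exists>z. \<forall>x. \<phi> x = cinner x z"
proof (cases "\<forall>x. \<phi> x = 0")
  case True
  then show ?thesis
    by (intro exI[of _ 0]) (simp add: cinner.zero_right)
next
  case False
  interpret bounded_linear \<phi> by fact
  define K where "K = {x. \<phi> x = 0}"
  have "csubspace K"
    by (auto simp: K_def complex_vector.subspace_def add zero hom)
  moreover have "closed K"
    unfolding K_def by (intro closed_Collect_eq continuous_intros continuous_on)
  moreover have "K \<noteq> UNIV"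
    using False by (auto simp: K_def)
  ultimately obtain f where f: "f \<noteq> 0" "\<And>x. x \<in> K \<Longrightarrow> cinner x f = 0"
    using ex_orthogonal_to_csubspace by metis
  have "\<phi> x = cinner x (cnj (\<phi> f / cinner f f) *\<^sub>C f)" for x
  proof -
    \<comment> \<open>The two terms cancel under \<open>\<phi>\<close>; pairing this combination
      with \<open>f\<close> then determines \<open>\<phi> x\<close>.\<close>
    have "\<phi> f *\<^sub>C x - \<phi> x *\<^sub>C f \<in> K"
      by (simp add: K_def diff hom)
    then have "\<phi> f * cinner x f = \<phi> x * cinner f f"
      using f(2) by (fastforce simp: cinner_diff_left cinner_scaleC_left)
    then show ?thesis
      using f(1) by (simp add: cinner_scaleC_right cinner_eq_zero_iff field_simps)
  qed
  then show ?thesis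
    by blast
qed

text \<open>Since \<open>cadjoint\<close> is chosen by \<open>SOME\<close>, a map with the adjoint
  property must first be shown to exist. Riesz representation of
  \<open>\<lambda>x. cinner (T x) y\<close>, for each \<open>y\<close>, supplies it.\<close>

lemma cinner_cadjoint:
  fixes T :: "'a::chilbert_space \<Rightarrow> 'b::chilbert_space"
  assumes "bounded_clinear T"
  shows "cinner (T x) y = cinner x (cadjoint T y)"
proof -
  have T: "bounded_linear T" and scale: "T (c *\<^sub>C x) = c *\<^sub>C T x" for c x
    using assms by (auto simp: bounded_clinear_def)
  have "\<exists>z. \<forall>x. cinner (T x) y = cinner x z" for y
    by (rule Riesz_representation)
      (simp_all add: bounded_linear_compose[OF cinner.bounded_linear_left T] scale
        cinner_scaleC_left)
  then have "\<exists>S. \<forall>x y. cinner (T x) y = cinner x (S y)"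
    by metis
  then show ?thesis
    unfolding cadjoint_def by (rule someI2_ex) blast
qed

lemma cinner_cadjoint_funpow:
  fixes T :: "'a::chilbert_space \<Rightarrow> 'a"
  assumes "bounded_clinear T"
  shows "cinner ((T ^^ r) x) y = cinner x ((cadjoint T ^^ r) y)"
  by (induction r arbitrary: x) (simp_all add: cinner_cadjoint[OF assms] funpow_swap1)

text \<open>A basis of \<open>M\<close> lying inside a finitely generated span is itself finite, and
  it would span \<open>M\<close>.\<close>

lemma infinite_cdim_not_subset_finite_span:
  assumes "csubspace M" "infinite_cdim M" "finite F"
  shows "\<not> M \<subseteq> cspan F"
proof
  assume sub: "M \<subseteq> cspan F"
  obtain B where B: "B \<subseteq> M" "complex_vector.independent B" "M \<subseteq> cspan B"
    using complex_vector.basis_exists by metis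
  have "finite B"
    using complex_vector.independent_span_bound[OF \<open>finite F\<close> B(2)] B(1) sub by blast
  moreover have "cspan B = M"
    using B complex_vector.span_minimal[OF B(1) assms(1)] by blast
  ultimately show False
    using assms(2) by (auto simp: infinite_cdim_def)
qed

section \<open>Orthonormal expansions\<close>

lemma orthonormal_basisD:
  "orthonormal_basis e \<Longrightarrow> cinner (e m) (e n) = (if m = n then 1 else 0)"
  by (simp add: orthonormal_basis_def)

text \<open>A partial sum is the orthogonal projection onto the span of the first \<open>n\<close>
  basis vectors, so it is at least as close to \<open>y\<close> as any element of that span. Density
  supplies an element that is close enough.\<close>

lemma orthonormal_expansion:
  fixes e :: "nat \<Rightarrow> 'a::chilbert_space"
  assumes e: "orthonormal_basis e"
  shows "(\<lambda>n. cinner y (e n) *\<^sub>C e n) sums y"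
  unfolding sums_def
proof (rule metric_LIMSEQ_I)
  fix \<epsilon> :: real
  assume "0 < \<epsilon>"
  moreover have "y \<in> closure (cspan (range e))"
    using e by (simp add: orthonormal_basis_def)
  ultimately obtain z where z: "z \<in> cspan (range e)" "dist z y < \<epsilon>"
    by (meson closure_approachable)
  then obtain t r where t: "finite t" "t \<subseteq> range e" and z_eq: "z = (\<Sum>a\<in>t. r a *\<^sub>C a)"
    unfolding complex_vector.span_explicit by blast
  obtain I where I: "finite I" "t = e ` I"
    using finite_subset_image[OF t] by blast
  obtain N where N: "I \<subseteq> {..<N}"
    using I(1) finite_nat_iff_bounded by blast
  have "dist (\<Sum>i<n. cinner y (e i) *\<^sub>C e i) y < \<epsilon>" if "N \<le> n" for n
  proof -
    define P where "P = (\<Sum>i<n. cinner y (e i) *\<^sub>C e i)"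
    have sub: "cspan t \<subseteq> cspan (e ` {..<n})"
      using I(2) N that by (intro complex_vector.span_mono) auto
    have "z \<in> cspan t"
      unfolding z_eq
      by (intro complex_vector.span_sum complex_vector.span_scale complex_vector.span_base)
    moreover have "P \<in> cspan (e ` {..<n})"
      unfolding P_def
      by (intro complex_vector.span_sum complex_vector.span_scale complex_vector.span_base) auto
    ultimately have "P - z \<in> cspan (e ` {..<n})"
      using sub by (blast intro: complex_vector.span_diff)
    \<comment> \<open>\<open>y - P\<close> is orthogonal to the first \<open>n\<close> basis vectors
      and hence to their span, so \<open>y - z\<close> splits orthogonally into \<open>y - P\<close>
      and \<open>P - z\<close>.\<close>
    moreover have "cspan (e ` {..<n}) \<subseteq> {v. cinner (y - P) v = 0}"
    proof (rule complex_vector.span_minimal)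
      show "e ` {..<n} \<subseteq> {v. cinner (y - P) v = 0}"
        by (auto simp: P_def cinner_diff_left cinner.sum_left cinner_scaleC_left
            orthonormal_basisD[OF e] if_distrib[of "\<lambda>u. _ * u"] cong: if_cong)
      show "csubspace {v. cinner (y - P) v = 0}"
        by (auto simp: complex_vector.subspace_def cinner.zero_right cinner_add_right
            cinner_scaleC_right)
    qed
    ultimately have "(norm ((y - P) + (P - z)))\<^sup>2 = (norm (y - P))\<^sup>2 + (norm (P - z))\<^sup>2"
      by (intro norm_add_square_orthogonal) auto
    then have "(norm (y - P))\<^sup>2 \<le> (norm (y - z))\<^sup>2"
      by simp
    then have "norm (y - P) \<le> norm (y - z)"
      by (rule power2_le_imp_le) simp
    then show ?thesis
      using z(2) by (simp add: P_def dist_norm norm_minus_commute)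
  qed
  then show "\<exists>N. \<forall>n\<ge>N. dist (\<Sum>i<n. cinner y (e i) *\<^sub>C e i) y < \<epsilon>"
    by blast
qed

lemma Parseval:
  fixes e :: "nat \<Rightarrow> 'a::chilbert_space"
  assumes "orthonormal_basis e"
  shows "(\<lambda>n. cinner x (e n) * cnj (cinner y (e n))) sums cinner x y"
  using bounded_linear.sums[OF cinner.bounded_linear_right orthonormal_expansion[OF assms]]
  by (simp add: cinner_scaleC_right mult.commute)

lemma summable_coefficients_square:
  fixes e :: "nat \<Rightarrow> 'a::chilbert_space"
  assumes "orthonormal_basis e"
  shows "summable (\<lambda>n. (cmod (cinner y (e n)))\<^sup>2)"
proof -
  have "summable (\<lambda>n. complex_of_real ((cmod (cinner y (e n)))\<^sup>2))"
    using sums_summable[OF Parseval[OF assms, of y y]] by (simp only: complex_norm_square)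
  then show ?thesis
    by (simp only: summable_of_real_iff)
qed

text \<open>The expansion reduces to a finite sum. For \<open>N = 0\<close> the span is trivial, so
  a nonzero vector has a nonzero coefficient.\<close>

lemma in_cspan_if_coefficients_eq_0:
  fixes e :: "nat \<Rightarrow> 'a::chilbert_space"
  assumes "orthonormal_basis e" "\<And>n. N \<le> n \<Longrightarrow> cinner x (e n) = 0"
  shows "x \<in> cspan (e ` {..<N})"
proof -
  have "(\<lambda>n. cinner x (e n) *\<^sub>C e n) sums (\<Sum>n<N. cinner x (e n) *\<^sub>C e n)"
    using assms(2) by (intro sums_finite) auto
  then have "x = (\<Sum>n<N. cinner x (e n) *\<^sub>C e n)"
    using orthonormal_expansion[OF assms(1), of x] sums_unique2 by blast
  also have "\<dots> \<in> cspan (e ` {..<N})"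
    by (intro complex_vector.span_sum complex_vector.span_scale complex_vector.span_base) auto
  finally show ?thesis .
qed

section \<open>Weighted shifts\<close>

text \<open>Parseval applied to \<open>g\<close> and \<open>cadjoint T (e m)\<close> reduces the
  coefficients of \<open>T g\<close> to the known vectors \<open>T (e i)\<close>; at most one term
  survives.\<close>

lemma coefficients_shift:
  fixes e :: "nat \<Rightarrow> 'a::chilbert_space"
  assumes e: "orthonormal_basis e" and T: "forward_weighted_shift e w T"
  shows "cinner (T g) (e (Suc n)) = complex_of_real (w n) * cinner g (e n)"
    and "cinner (T g) (e 0) = 0"
proof -
  have bT: "bounded_clinear T" and Te: "T (e n) = complex_of_real (w n) *\<^sub>C e (Suc n)" for n
    using T by (auto simp: forward_weighted_shift_def)
  have *: "(\<lambda>i. cinner g (e i) * (if Suc i = m then complex_of_real (w i) else 0))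
      sums cinner (T g) (e m)" for m
  proof -
    have "cnj (cinner (cadjoint T (e m)) (e i)) = cinner (T (e i)) (e m)" for i
      by (simp add: cinner_cadjoint[OF bT] cinner_commute[of "e i" "cadjoint T (e m)"])
    then show ?thesis
      using Parseval[OF e, of g "cadjoint T (e m)"]
      by (simp add: cinner_cadjoint[OF bT, of g, symmetric] Te cinner_scaleC_left
          orthonormal_basisD[OF e] if_distrib[of "\<lambda>u. _ * u"] cong: if_cong)
  qed
  show "cinner (T g) (e 0) = 0"
    using sums_unique2[OF _ sums_zero] *[of 0] by simp
  have "(\<lambda>i. if i = n then complex_of_real (w i) * cinner g (e i) else 0)
      sums (complex_of_real (w n) * cinner g (e n))"
    by (rule sums_single)
  moreover have "(\<lambda>i. if i = n then complex_of_real (w i) * cinner g (e i) else 0)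
      sums cinner (T g) (e (Suc n))"
    using *[of "Suc n"] by (simp add: if_distrib[of "\<lambda>u. _ * u"] mult.commute cong: if_cong)
  ultimately show "cinner (T g) (e (Suc n)) = complex_of_real (w n) * cinner g (e n)"
    using sums_unique2 by blast
qed

lemma coefficients_shift_funpow:
  fixes e :: "nat \<Rightarrow> 'a::chilbert_space"
  assumes e: "orthonormal_basis e" and T: "forward_weighted_shift e w T"
  shows "cinner ((T ^^ r) g) (e (i + r)) = complex_of_real (\<Prod>j<r. w (i + j)) * cinner g (e i)"
    and "n < r \<Longrightarrow> cinner ((T ^^ r) g) (e n) = 0"
proof -
  show "cinner ((T ^^ r) g) (e (i + r)) = complex_of_real (\<Prod>j<r. w (i + j)) * cinner g (e i)"
    by (induction r) (simp_all add: coefficients_shift[OF e T])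
  show "cinner ((T ^^ r) g) (e n) = 0" if "n < r"
    using that
  proof (induction r arbitrary: n)
    case (Suc r)
    then show ?case
      by (cases n) (simp_all add: coefficients_shift[OF e T])
  qed simp
qed

section \<open>Weight ratios: decay and uniform square-sum bounds\<close>

text \<open>\<open>T ^^ r\<close> scales the coefficient at \<open>p + k\<close> by the numerator
  and the one at \<open>p\<close> by the denominator. The ratio is thus the relative weight left
  after normalizing the leading term.\<close>

definition shift_ratio :: "(nat \<Rightarrow> real) \<Rightarrow> nat \<Rightarrow> nat \<Rightarrow> nat \<Rightarrow> real" where
  "shift_ratio w p r k = (\<Prod>j<r. w (p + k + j)) / (\<Prod>j<r. w (p + j))"

lemma shift_ratio_nonneg: "(\<And>n. 0 < w n) \<Longrightarrow> 0 \<le> shift_ratio w p r k"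
  by (simp add: shift_ratio_def prod_nonneg less_imp_le)

text \<open>After cancellation only \<open>k\<close> weights remain above and below. The lower ones
  are fixed, while the indices of the upper ones grow with \<open>r\<close>.\<close>

lemma shift_ratio_tendsto_0:
  assumes pos: "\<And>n. 0 < w n" and "w \<longlonglongrightarrow> 0" and "0 < k"
  shows "(\<lambda>r. shift_ratio w p r k) \<longlonglongrightarrow> 0"
proof -
  \<comment> \<open>Splitting the product of \<open>r + k\<close> consecutive weights after
    \<open>r\<close> and after \<open>k\<close> factors gives the cancellation.\<close>
  have split: "(\<Prod>j<m + n. w (p + j)) = (\<Prod>j<m. w (p + j)) * (\<Prod>j<n. w (p + m + j))" for m n
    by (induction n) (simp_all add: algebra_simps)
  have nz: "(\<Prod>j<n. w (p + j)) \<noteq> 0" for n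
    using pos by (simp add: less_imp_neq[symmetric])
  have eq: "shift_ratio w p r k = (\<Prod>j<k. w (r + (p + j))) / (\<Prod>j<k. w (p + j))" for r
    using split[of r k] split[of k r] nz[of r] nz[of k]
    by (simp add: shift_ratio_def field_simps add_ac)
  have "(\<lambda>r. \<Prod>j<k. w (r + (p + j))) \<longlonglongrightarrow> (\<Prod>j<k. 0)"
    by (intro tendsto_prod LIMSEQ_ignore_initial_segment assms(2))
  then have "(\<lambda>r. \<Prod>j<k. w (r + (p + j))) \<longlonglongrightarrow> 0"
    using \<open>0 < k\<close> by (simp add: zero_power)
  then show ?thesis
    unfolding eq by (rule tendsto_divide_zero)
qed

text \<open>The pair \<open>m = p\<close>, \<open>n = p + r - 1\<close> turns the series in the
  condition into that of the squared ratios; it is admissible because \<open>2 \<le> p\<close> and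
  \<open>0 < r\<close>.\<close>

lemma weight_condition_A_ratio_bound:
  assumes A: "weight_condition_A w" and "2 \<le> p"
  shows "\<exists>C. \<forall>r K. 0 < r \<longrightarrow> (\<Sum>k<K. (shift_ratio w p r k)\<^sup>2) \<le> C"
proof -
  define S where "S = (SUP (m, n) \<in> {(m, n). 2 \<le> m \<and> m \<le> n}.
        \<Sum>k. ennreal (((\<Prod>j = m..n. w (k + j)) / (\<Prod>j = m..n. w j))\<^sup>2))"
  have S: "S < \<infinity>"
    using A unfolding weight_condition_A_def S_def .
  have "(\<Sum>k<K. (shift_ratio w p r k)\<^sup>2) \<le> enn2real S" if "0 < r" for r K
  proof -
    have shift: "(\<Prod>j = p..p + r - 1. f j) = (\<Prod>j<r. f (p + j))" for f :: "nat \<Rightarrow> real"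
      using \<open>0 < r\<close>
      by (intro prod.reindex_bij_witness[of _ "\<lambda>j. p + j" "\<lambda>j. j - p"]) auto
    have ratio: "shift_ratio w p r k
        = (\<Prod>j = p..p + r - 1. w (k + j)) / (\<Prod>j = p..p + r - 1. w j)" for k
      unfolding shift_ratio_def shift by (simp add: add_ac)
    have "ennreal (\<Sum>k<K. (shift_ratio w p r k)\<^sup>2) = (\<Sum>k<K. ennreal ((shift_ratio w p r k)\<^sup>2))"
      by (rule sum_ennreal[symmetric]) simp
    also have "\<dots> \<le> (\<Sum>k. ennreal ((shift_ratio w p r k)\<^sup>2))"
      by (rule sum_le_suminf) simp_all
    also have "\<dots> \<le> S"
    proof -
      have "(p, p + r - 1) \<in> {(m, n). 2 \<le> m \<and> m \<le> n}"
        using \<open>0 < r\<close> \<open>2 \<le> p\<close> by (simp, linarith)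
      then show ?thesis
        unfolding S_def ratio by (rule SUP_upper2) (simp only: prod.case order_refl)
    qed
    finally have "enn2real (ennreal (\<Sum>k<K. (shift_ratio w p r k)\<^sup>2)) \<le> enn2real S"
      by (rule enn2real_mono) (use S in simp)
    then show ?thesis
      by (simp add: sum_nonneg)
  qed
  then show ?thesis
    by blast
qed

text \<open>By monotonicity every quotient of weights after the first is at most 1, so the ratio is
  at most \<open>w (p + k) / w p\<close>, hence at most \<open>w k / w p\<close>.\<close>

lemma weight_condition_B_ratio_bound:
  assumes pos: "\<And>n. 0 < w n" and B: "weight_condition_B w"
  shows "\<exists>C. \<forall>r K. 0 < r \<longrightarrow> (\<Sum>k<K. (shift_ratio w p r k)\<^sup>2) \<le> C"
proof -
  have anti: "w n \<le> w m" if "m \<le> n" for m n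
    using B that lift_Suc_antimono_le[of w m n] by (simp add: weight_condition_B_def)
  have sm: "summable (\<lambda>n. (w n)\<^sup>2)"
    using B by (simp add: weight_condition_B_def)
  have "(\<Sum>k<K. (shift_ratio w p r k)\<^sup>2) \<le> (\<Sum>n. (w n)\<^sup>2) / (w p)\<^sup>2" if "0 < r" for r K
  proof -
    obtain s where r: "r = Suc s"
      using \<open>0 < r\<close> gr0_implies_Suc by blast
    have "(shift_ratio w p r k)\<^sup>2 \<le> (w k)\<^sup>2 / (w p)\<^sup>2" for k
    proof -
      have "shift_ratio w p r k = w (p + k) / w p * (\<Prod>j<s. w (p + k + Suc j) / w (p + Suc j))"
        unfolding shift_ratio_def r prod.lessThan_Suc_shift prod_dividef by simp
      also have "\<dots> \<le> w (p + k) / w p * 1"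
      proof (rule mult_left_mono)
        have "w (p + k + Suc j) / w (p + Suc j) \<le> 1" for j
          using anti[of "p + Suc j" "p + k + Suc j"] pos[of "p + Suc j"] by simp
        moreover have "0 \<le> w (p + k + Suc j) / w (p + Suc j)" for j
          by (rule divide_nonneg_nonneg) (rule less_imp_le[OF pos])+
        ultimately show "(\<Prod>j<s. w (p + k + Suc j) / w (p + Suc j)) \<le> 1"
          by (rule prod_le_1[OF conjI, rotated])
        show "0 \<le> w (p + k) / w p"
          by (rule divide_nonneg_nonneg) (rule less_imp_le[OF pos])+
      qed
      also have "\<dots> \<le> w k / w p"
        using anti[of k "p + k"] pos[of p] by (simp add: divide_right_mono)
      finally show ?thesis
        unfolding power_divide[symmetric]
        by (rule power_mono) (rule shift_ratio_nonneg[OF pos])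
    qed
    then have "(\<Sum>k<K. (shift_ratio w p r k)\<^sup>2) \<le> (\<Sum>k<K. (w k)\<^sup>2 / (w p)\<^sup>2)"
      by (rule sum_mono)
    also have "\<dots> \<le> (\<Sum>n. (w n)\<^sup>2) / (w p)\<^sup>2"
      unfolding sum_divide_distrib[symmetric]
      by (rule divide_right_mono) (simp_all add: sum_le_suminf[OF sm])
    finally show ?thesis .
  qed
  then show ?thesis
    by blast
qed

text \<open>For \<open>r = 1\<close> the ratio is \<open>w (p + k) / w p\<close>, so the bound makes
  these quotients square-summable in \<open>k\<close>.\<close>

lemma weights_tendsto_0:
  assumes pos: "\<And>n. 0 < w n"
    and bound: "\<forall>r K. 0 < r \<longrightarrow> (\<Sum>k<K. (shift_ratio w p r k)\<^sup>2) \<le> C"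
  shows "w \<longlonglongrightarrow> 0"
proof -
  have "summable (\<lambda>k. (w (p + k) / w p)\<^sup>2)"
    using bound[rule_format, of 1]
    by (intro bounded_imp_summable[where B = C])
      (simp_all add: shift_ratio_def lessThan_Suc_atMost[symmetric] del: sum.lessThan_Suc)
  then have "(\<lambda>k. (w (p + k) / w p)\<^sup>2) \<longlonglongrightarrow> 0"
    by (rule summable_LIMSEQ_zero)
  then have "(\<lambda>k. w p * sqrt ((w (p + k) / w p)\<^sup>2)) \<longlonglongrightarrow> w p * sqrt 0"
    by (intro tendsto_intros)
  then have "(\<lambda>k. w (k + p)) \<longlonglongrightarrow> 0"
    using pos by (simp add: abs_of_pos less_imp_neq[symmetric] add.commute)
  then show ?thesis
    by (rule LIMSEQ_offset)
qed

text \<open>Each ratio with \<open>k \<ge> 1\<close> vanishes as \<open>r\<close> grows, and the uniform \<open>\<ell>\<^sup>2\<close> bound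
  controls the part of the sum where the square-summable factor has a small tail.\<close>

lemma eventually_weighted_ratio_sum_small:
  fixes a :: "nat \<Rightarrow> real"
  assumes pos: "\<And>n. 0 < w n" and w0: "w \<longlonglongrightarrow> 0"
    and bound: "\<forall>r K. 0 < r \<longrightarrow> (\<Sum>k<K. (shift_ratio w p r k)\<^sup>2) \<le> C"
    and a: "summable (\<lambda>k. (a k)\<^sup>2)" "\<And>k. 0 \<le> a k" and "0 < \<epsilon>"
  shows "\<forall>\<^sub>F r in sequentially. \<forall>K. (\<Sum>k = 1..<K. a k * shift_ratio w p r k) \<le> \<epsilon>"
proof -
  let ?R = "shift_ratio w p"
  have R0: "0 \<le> ?R r k" for r k
    by (rule shift_ratio_nonneg[OF pos])
  have C0: "0 \<le> C"
    using bound[rule_format, of 1 0] by simp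
  \<comment> \<open>Chosen so that Cauchy-Schwarz bounds the tail by \<open>\<epsilon> / 2\<close>;
    \<open>C + 1\<close> keeps the denominator positive when \<open>C = 0\<close>.\<close>
  define \<delta> where "\<delta> = \<epsilon>\<^sup>2 / (4 * (C + 1))"
  have \<delta>: "0 < \<delta>" "\<delta> * C \<le> (\<epsilon> / 2)\<^sup>2"
    using \<open>0 < \<epsilon>\<close> C0 by (auto simp: \<delta>_def field_simps power2_eq_square)
  obtain L where L: "\<And>m n. L \<le> m \<Longrightarrow> norm (\<Sum>k = m..<n. (a k)\<^sup>2) < \<delta>"
    using a(1)[unfolded summable_Cauchy] \<delta>(1) by blast
  have tail: "(\<Sum>k = Suc L..<K. a k * ?R r k) \<le> \<epsilon> / 2" if "0 < r" for r K
  proof (rule power2_le_imp_le)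
    have "(\<Sum>k = Suc L..<K. a k * ?R r k)\<^sup>2
        \<le> (\<Sum>k = Suc L..<K. (a k)\<^sup>2) * (\<Sum>k = Suc L..<K. (?R r k)\<^sup>2)"
      by (rule Cauchy_Schwarz_ineq_sum)
    also have "\<dots> \<le> \<delta> * (\<Sum>k<K. (?R r k)\<^sup>2)"
      using L[of "Suc L" K] \<delta>(1)
      by (intro mult_mono sum_mono2 sum_nonneg) auto
    also have "\<dots> \<le> \<delta> * C"
      using bound that \<delta>(1) by (intro mult_left_mono) auto
    finally show "(\<Sum>k = Suc L..<K. a k * ?R r k)\<^sup>2 \<le> (\<epsilon> / 2)\<^sup>2"
      using \<delta>(2) by simp
  qed (use \<open>0 < \<epsilon>\<close> in simp)
  \<comment> \<open>Only finitely many indices remain, and each ratio tends to 0. The sum starts at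
    1 because the ratio at \<open>k = 0\<close> is constantly 1.\<close>
  have "(\<lambda>r. \<Sum>k = 1..L. a k * ?R r k) \<longlonglongrightarrow> (\<Sum>k = 1..L. a k * 0)"
    by (intro tendsto_sum tendsto_mult tendsto_const shift_ratio_tendsto_0 pos w0) auto
  then have "\<forall>\<^sub>F r in sequentially. (\<Sum>k = 1..L. a k * ?R r k) < \<epsilon> / 2"
    by (rule order_tendstoD) (use \<open>0 < \<epsilon>\<close> in simp)
  then show ?thesis
    using eventually_gt_at_top[of 0]
  proof eventually_elim
    case (elim r)
    show ?case
    proof
      fix K
      have "(\<Sum>k = 1..<K. a k * ?R r k) \<le> (\<Sum>k \<in> {1..L} \<union> {Suc L..<K}. a k * ?R r k)"
        by (intro sum_mono2) (auto simp: a R0)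
      also have "\<dots> = (\<Sum>k = 1..L. a k * ?R r k) + (\<Sum>k = Suc L..<K. a k * ?R r k)"
        by (intro sum.union_disjoint) auto
      finally show "(\<Sum>k = 1..<K. a k * ?R r k) \<le> \<epsilon>"
        using elim(1) tail[OF elim(2), of K] by argo
    qed
  qed
qed

section \<open>Coefficients of vectors orthogonal to the orbit of \<open>g\<close>\<close>

text \<open>Parseval turns orthogonality into a vanishing series that starts at index
  \<open>p + r\<close>. After division by the weight product of its leading term, that term is
  bounded by the sum of the moduli of the others.\<close>

lemma coefficient_bound_of_orthogonal:
  fixes e :: "nat \<Rightarrow> 'a::chilbert_space"
  assumes e: "orthonormal_basis e" and T: "forward_weighted_shift e w T"
    and orth: "cinner x ((T ^^ r) g) = 0"
    and g0: "\<And>i. i < p \<Longrightarrow> cinner g (e i) = 0"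
    and S: "\<And>k. cmod (cinner x (e (p + r + k))) \<le> S"
    and small: "\<And>K. (\<Sum>k = 1..<K. cmod (cinner g (e (p + k))) * shift_ratio w p r k) \<le> \<epsilon>"
  shows "cmod (cinner x (e (p + r))) * cmod (cinner g (e p)) \<le> S * \<epsilon>"
proof -
  have pos: "0 < w n" for n
    using T by (simp add: forward_weighted_shift_def)
  define W where "W = (\<Prod>j<r. w (p + j))"
  have W: "0 < W"
    unfolding W_def by (intro prod_pos) (simp add: pos)
  define b where "b k = cinner x (e (p + r + k)) * cnj (cinner g (e (p + k)))
    * complex_of_real (shift_ratio w p r k)" for k
  have zero: "cinner ((T ^^ r) g) (e n) = 0" if "n < p + r" for n
  proof (cases "n < r")
    case True
    then show ?thesis
      by (rule coefficients_shift_funpow(2)[OF e T])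
  next
    case False
    then show ?thesis
      using that g0[of "n - r"] coefficients_shift_funpow(1)[OF e T, of r g "n - r"] by simp
  qed
  \<comment> \<open>By \<open>zero\<close> the first \<open>p + r\<close> terms vanish, so dropping
    them leaves the sum unchanged.\<close>
  have "(\<lambda>k. cinner x (e (k + (p + r))) * cnj (cinner ((T ^^ r) g) (e (k + (p + r))))) sums 0"
    using Parseval[OF e, of x "(T ^^ r) g"] zero orth by (subst sums_iff_shift) simp
  moreover have "cinner x (e (k + (p + r))) * cnj (cinner ((T ^^ r) g) (e (k + (p + r))))
      = complex_of_real W * b k" for k
  proof -
    have idx: "k + (p + r) = p + k + r" "p + r + k = p + k + r"
      by simp_all
    have "(\<Prod>j<r. w (p + k + j)) = W * shift_ratio w p r k"
      using W by (simp add: shift_ratio_def W_def[symmetric])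
    then show ?thesis
      unfolding b_def idx coefficients_shift_funpow(1)[OF e T] by (simp add: mult_ac)
  qed
  ultimately have "(\<lambda>k. complex_of_real W * b k) sums (complex_of_real W * 0)"
    by simp
  then have "b sums 0"
    using W by (subst (asm) sums_mult_iff) auto
  \<comment> \<open>Subtracting partial sums from \<open>b 0\<close> leaves finite sums over
    \<open>k \<ge> 1\<close>, to which \<open>small\<close> applies before the limit is
    taken.\<close>
  then have lim: "(\<lambda>K. cmod (b 0 - (\<Sum>k<K. b k))) \<longlonglongrightarrow> cmod (b 0 - 0)"
    unfolding sums_def by (intro tendsto_intros)
  have S0: "0 \<le> S"
    using S[of 0] norm_ge_zero order_trans by blast
  have "cmod (b 0 - (\<Sum>k<K. b k)) \<le> S * \<epsilon>" if "1 \<le> K" for K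
  proof -
    have "(\<Sum>k<K. b k) = b 0 + (\<Sum>k = 1..<K. b k)"
      using that by (simp add: lessThan_atLeast0 sum.atLeast_Suc_lessThan)
    then have "cmod (b 0 - (\<Sum>k<K. b k)) = cmod (\<Sum>k = 1..<K. b k)"
      by simp
    also have "\<dots> \<le> (\<Sum>k = 1..<K. S * (cmod (cinner g (e (p + k))) * shift_ratio w p r k))"
      using S S0 shift_ratio_nonneg[of w, OF pos]
      by (intro sum_norm_le) (auto simp: b_def norm_mult mult.assoc intro!: mult_mono)
    also have "\<dots> \<le> S * \<epsilon>"
      unfolding sum_distrib_left[symmetric] using small S0 by (intro mult_left_mono) auto
    finally show ?thesis .
  qed
  then have "cmod (b 0 - 0) \<le> S * \<epsilon>"
    by (intro LIMSEQ_le_const2[OF lim]) blast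
  moreover have "shift_ratio w p r 0 = 1"
    using W by (simp add: shift_ratio_def W_def[symmetric])
  ultimately show ?thesis
    by (simp add: b_def norm_mult)
qed

text \<open>Taking half the leading modulus \<open>a 0\<close> as the smallness bound makes every
  coefficient of \<open>x\<close> from \<open>p + q\<close> on at most half of their supremum. The
  choice of \<open>q\<close> involves only \<open>g\<close>, \<open>w\<close> and \<open>p\<close>,
  so the cutoff is uniform in \<open>x\<close>.\<close>

lemma coefficients_eventually_0_of_orthogonal:
  fixes e :: "nat \<Rightarrow> 'a::chilbert_space"
  assumes e: "orthonormal_basis e" and T: "forward_weighted_shift e w T"
    and w0: "w \<longlonglongrightarrow> 0"
    and bound: "\<forall>r K. 0 < r \<longrightarrow> (\<Sum>k<K. (shift_ratio w p r k)\<^sup>2) \<le> C"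
    and g0: "\<And>i. i < p \<Longrightarrow> cinner g (e i) = 0" and gp: "cinner g (e p) \<noteq> 0"
  shows "\<exists>N. \<forall>x. (\<forall>r. cinner x ((T ^^ r) g) = 0) \<longrightarrow> (\<forall>n\<ge>N. cinner x (e n) = 0)"
proof -
  have pos: "0 < w n" for n
    using T by (simp add: forward_weighted_shift_def)
  define a where "a k = cmod (cinner g (e (p + k)))" for k
  have "summable (\<lambda>k. (a k)\<^sup>2)"
    using summable_ignore_initial_segment[OF summable_coefficients_square[OF e, of g], of p]
    by (simp add: a_def add.commute)
  then have "\<forall>\<^sub>F r in sequentially. \<forall>K. (\<Sum>k = 1..<K. a k * shift_ratio w p r k) \<le> a 0 / 2"
    using gp by (intro eventually_weighted_ratio_sum_small[OF pos w0 bound]) (auto simp: a_def)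
  then obtain q where q: "\<And>r K. q \<le> r \<Longrightarrow> (\<Sum>k = 1..<K. a k * shift_ratio w p r k) \<le> a 0 / 2"
    unfolding eventually_sequentially by blast
  have "cinner x (e n) = 0" if x: "\<And>r. cinner x ((T ^^ r) g) = 0" and n: "p + q \<le> n" for x n
  proof -
    define S where "S = (SUP m\<in>{p + q..}. cmod (cinner x (e m)))"
    have "cmod (cinner x (e m)) \<le> norm x" for m
    proof -
      have "norm (e m) = 1"
        using orthonormal_basisD[OF e, of m m] by (simp add: norm_eq_sqrt_cinner)
      then show ?thesis
        using cinner_Cauchy_Schwarz[of x "e m"] by simp
    qed
    then have le_S: "cmod (cinner x (e m)) \<le> S" if "p + q \<le> m" for m
      unfolding S_def using that by (intro cSUP_upper) (auto intro!: bdd_aboveI2)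
    have half: "cmod (cinner x (e m)) \<le> S / 2" if "p + q \<le> m" for m
    proof -
      have m: "p + (m - p) = m"
        using that by simp
      have "cmod (cinner x (e (p + (m - p)))) * cmod (cinner g (e p)) \<le> S * (a 0 / 2)"
      proof (rule coefficient_bound_of_orthogonal[OF e T x g0])
        show "cmod (cinner x (e (p + (m - p) + k))) \<le> S" for k
          using that by (intro le_S) simp
        show "(\<Sum>k = 1..<K. cmod (cinner g (e (p + k))) * shift_ratio w p (m - p) k) \<le> a 0 / 2" for K
          using q[of "m - p" K] that unfolding a_def by linarith
      qed
      then show ?thesis
        using gp unfolding m by (simp add: a_def)
    qed
    \<comment> \<open>The left side is \<open>S\<close> itself, and \<open>S \<le> S / 2\<close>
      forces \<open>S \<le> 0\<close>.\<close>
    have "(SUP m\<in>{p + q..}. cmod (cinner x (e m))) \<le> S / 2"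
      by (rule cSUP_least) (use half in auto)
    then have "cmod (cinner x (e n)) \<le> 0"
      using le_S[OF n] unfolding S_def[symmetric] by linarith
    then show ?thesis
      by simp
  qed
  then show ?thesis
    by blast
qed

text \<open>Every exponent from 2 on is a sum of twos and threes; strong induction peels off
  \<open>f ^^ 2\<close> until exponent 2 or 3 is left.\<close>

lemma funpow_add_two_invariant:
  assumes "(f ^^ 2) ` M \<subseteq> M" "(f ^^ 3) ` M \<subseteq> M" "x \<in> M"
  shows "(f ^^ (r + 2)) x \<in> M"
proof (induction r rule: less_induct)
  case (less r)
  consider "r = 0" | "r = 1" | "2 \<le> r"
    by linarith
  then show ?case
  proof cases
    case 3
    then obtain s where s: "r = 2 + s"
      using le_Suc_ex by blast
    then have "(f ^^ (r + 2)) x = (f ^^ 2) ((f ^^ (s + 2)) x)"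
      by (simp add: numeral_2_eq_2)
    moreover have "(f ^^ (s + 2)) x \<in> M"
      by (rule less) (simp add: s)
    ultimately show ?thesis
      using assms(1) by (metis image_subset_iff)
  qed (use assms in \<open>auto simp: numeral_2_eq_2 numeral_3_eq_3\<close>)
qed

theorem theorem3p12:
  fixes e :: "nat \<Rightarrow> 'a::chilbert_space"
    and w :: "nat \<Rightarrow> real"
    and T :: "'a \<Rightarrow> 'a"
    and M :: "'a set"
  assumes "orthonormal_basis e"
    and "forward_weighted_shift e w T"
    and "weight_condition_A w \<or> weight_condition_B w"
    and "csubspace M" and "closed M" and "infinite_cdim M"
    and "(cadjoint T ^^ 2) ` M \<subseteq> M"
    and "(cadjoint T ^^ 3) ` M \<subseteq> M"
  shows "M = UNIV"
proof (rule ccontr)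
  note e = assms(1) and T = assms(2)
  have pos: "0 < w n" and bT: "bounded_clinear T" for n
    using T by (auto simp: forward_weighted_shift_def)
  assume "M \<noteq> UNIV"
  then obtain f where f: "f \<noteq> 0" and f_orth: "\<And>x. x \<in> M \<Longrightarrow> cinner x f = 0"
    using ex_orthogonal_to_csubspace[OF assms(4,5)] by metis
  \<comment> \<open>The two extra shifts serve two purposes: invariance covers only powers of the
    adjoint from 2 on, and the first nonzero coefficient moves to an index \<open>p \<ge> 2\<close>,
    as the range of \<open>m\<close> in \<open>weight_condition_A\<close> demands.\<close>
  define g where "g = (T ^^ 2) f"
  have orth: "cinner x ((T ^^ r) g) = 0" if "x \<in> M" for x r
  proof -
    have "cinner ((T ^^ (r + 2)) f) x = cinner f ((cadjoint T ^^ (r + 2)) x)"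
      by (rule cinner_cadjoint_funpow[OF bT])
    also have "\<dots> = 0"
      using f_orth[OF funpow_add_two_invariant[OF assms(7,8) that]]
      by (subst cinner_commute) simp
    finally have "cinner ((T ^^ r) g) x = 0"
      by (simp only: g_def funpow_add o_apply)
    then show ?thesis
      by (subst cinner_commute) simp
  qed
  obtain i where "cinner f (e i) \<noteq> 0"
    using f in_cspan_if_coefficients_eq_0[OF e, of 0 f] by auto
  then have ex: "\<exists>n. cinner g (e n) \<noteq> 0"
    unfolding g_def
    using coefficients_shift_funpow(1)[OF e T, of 2 f i] pos
    by (intro exI[of _ "i + 2"]) (simp add: less_imp_neq[symmetric])
  define p where "p = (LEAST n. cinner g (e n) \<noteq> 0)"
  have gp: "cinner g (e p) \<noteq> 0" and g0: "\<And>i. i < p \<Longrightarrow> cinner g (e i) = 0"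
    unfolding p_def using LeastI_ex[OF ex] not_less_Least by auto
  have "2 \<le> p"
    using gp coefficients_shift_funpow(2)[OF e T, of p 2 f] unfolding g_def by linarith
  then obtain C where C: "\<forall>r K. 0 < r \<longrightarrow> (\<Sum>k<K. (shift_ratio w p r k)\<^sup>2) \<le> C"
    using assms(3) weight_condition_A_ratio_bound[of w p] weight_condition_B_ratio_bound[of w p, OF pos]
    by blast
  obtain N where N: "\<forall>x. (\<forall>r. cinner x ((T ^^ r) g) = 0) \<longrightarrow> (\<forall>n\<ge>N. cinner x (e n) = 0)"
    using coefficients_eventually_0_of_orthogonal[OF e T weights_tendsto_0[OF pos C] C g0 gp]
    by (rule exE)
  have "M \<subseteq> cspan (e ` {..<N})"
  proof
    fix x
    assume "x \<in> M"
    then have "\<forall>n\<ge>N. cinner x (e n) = 0"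
      using N orth by simp
    then show "x \<in> cspan (e ` {..<N})"
      by (intro in_cspan_if_coefficients_eq_0[OF e]) simp
  qed
  then show False
    using infinite_cdim_not_subset_finite_span[OF assms(4,6)] by blast
qed

end
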